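(* There exists $\rho_*\in(0,1)$ such that for every controllable pair $(A,b)\in M_2(\mathbb{R})\times\mathbb{R}^2$, every $T>0$ and every $\rho\in(0,\rho_* )$ one has $\mathrm{RC}(A,T,\rho T)<+\infty$.
   Context: For $0<\mu\leq T$, $\mathcal{G}(T,\mu)$ denotes the set of all measurable functions $\alpha:[0,\infty)\to[0,1]$ such that $\int_t^{t+T}\alpha(s)\,ds\geq\mu$ for every $t\geq 0$. Let $(A,b)\in M_n(\mathbb{R})\times\mathbb{R}^n$ be a controllable pair. For $K\in\mathbb{R}^n$, $\alpha\in\mathcal{G}(T,\mu)$ and $x_0\in\mathbb{R}^n$, let $x(\cdot;0,x_0,K,\alpha)$ be the solution of $\dot x=(A-\alpha(t)bK^T)x$, $x(0)=x_0$. Define $$\lambda^+(\alpha,K)=\sup_{\|x_0\|=1}\limsup_{t\to+\infty}\frac{\log\|x(t;0,x_0,K,\alpha)\|}{t},$$ $$\mathrm{rc}(A,b,T,\mu,K)=-\sup_{\alpha\in\mathcal{G}(T,\mu)}\lambda^+(\alpha,K),\qquad \mathrm{RC}(A,T,\mu)=\sup_{K\in\mathbb{R}^n}\mathrm{rc}(A,b,T,\mu,K).$$ The quantity $\mathrm{RC}(A,T,\mu)$ (maximal rate of convergence) does not depend on the choice of $b$ such that $(A,b)$ is controllable. *)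

theory Defs
  imports "HOL-Analysis.Analysis"
begin

text \<open>Kalman's rank condition: the columns \<open>b, A b, ..., A\<^sup>n\<^sup>-\<^sup>1 b\<close> of the controllability
  matrix have rank \<open>n\<close>.  Function iteration is used because the power operation on
  \<open>real^'n^'n\<close> is componentwise.\<close>

definition controllable :: "real^'n^'n \<Rightarrow> real^'n \<Rightarrow> bool" where
  "controllable A b \<longleftrightarrow> dim {(((*v) A) ^^ i) b | i. i < CARD('n)} = CARD('n)"

text \<open>Functions on the half line are represented by functions on \<open>real\<close> whose values at negative
  arguments are irrelevant.  The Henstock--Kurzweil integral below is that of a bounded
  Lebesgue-measurable function, hence equal to its Lebesgue integral.\<close>

definition PE :: "real \<Rightarrow> real \<Rightarrow> (real \<Rightarrow> real) set" where
  "PE T \<mu> = {\<alpha>. \<alpha> \<in> borel_measurable (lebesgue_on {0..}) \<and> (\<forall>t\<ge>0. 0 \<le> \<alpha> t \<and> \<alpha> t \<le> 1) \<and>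
     (\<forall>t\<ge>0. integral {t..t+T} \<alpha> \<ge> \<mu>)}"

definition closed_loop :: "real^'n^'n \<Rightarrow> real^'n \<Rightarrow> real^'n \<Rightarrow> real \<Rightarrow> real^'n^'n" where
  "closed_loop A b K a = A - a *\<^sub>R ((columnvector b :: real^1^'n) ** (rowvector K :: real^'n^1))"

text \<open>Caratheodory solutions on the half line, in integral form.  The equation forces \<open>x\<close> to be
  continuous, so for \<open>\<alpha>\<close> in \<open>PE T \<mu>\<close> the integrand is bounded and measurable on compact
  intervals: \<open>x\<close> is locally absolutely continuous and satisfies the differential equation almost
  everywhere.\<close>

definition solution ::
  "real^'n^'n \<Rightarrow> real^'n \<Rightarrow> real^'n \<Rightarrow> (real \<Rightarrow> real) \<Rightarrow> real^'n \<Rightarrow> (real \<Rightarrow> real^'n) \<Rightarrow> bool" where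
  "solution A b K \<alpha> x0 x \<longleftrightarrow>
     (\<forall>t\<ge>0. ((\<lambda>s. closed_loop A b K (\<alpha> s) *v x s) has_integral (x t - x0)) {0..t})"

text \<open>For each \<open>x0\<close> the solution exists and is unique on the half line, so the supremum over
  pairs \<open>(x0, x)\<close> is the supremum over the initial conditions \<open>x0\<close> on the unit sphere.
  A nonzero solution never vanishes, so the logarithm is that of a positive number.\<close>

definition lyap_max ::
  "real^'n^'n \<Rightarrow> real^'n \<Rightarrow> real^'n \<Rightarrow> (real \<Rightarrow> real) \<Rightarrow> ereal" where
  "lyap_max A b K \<alpha> =
     (SUP (x0, x) \<in> {(x0, x). norm x0 = 1 \<and> solution A b K \<alpha> x0 x}.
        Limsup at_top (\<lambda>t. ereal (ln (norm (x t)) / t)))"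

definition rc :: "real^'n^'n \<Rightarrow> real^'n \<Rightarrow> real \<Rightarrow> real \<Rightarrow> real^'n \<Rightarrow> ereal" where
  "rc A b T \<mu> K = - (SUP \<alpha> \<in> PE T \<mu>. lyap_max A b K \<alpha>)"

text \<open>For controllable \<open>(A, b)\<close> this value does not depend on \<open>b\<close>; the argument \<open>b\<close> is kept
  explicit.\<close>

definition RC :: "real^'n^'n \<Rightarrow> real^'n \<Rightarrow> real \<Rightarrow> real \<Rightarrow> ereal" where
  "RC A b T \<mu> = (SUP K. rc A b T \<mu> K)"

end

theory Submission
  imports Defs
begin

text \<open>Put \<open>\<sigma> = tr A / 2\<close> and \<open>e = A b - \<sigma> b\<close>.  In the coordinates
  \<open>z = exp (\<sigma> t) (x e + v b)\<close> the system reads \<open>x' = v\<close>, \<open>v' = a x - \<alpha> (k\<^sub>1 x + k\<^sub>2 v)\<close>, and for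
  every gain one has to exhibit a persistently exciting signal with a trajectory whose decay rate is
  bounded independently of \<open>k\<^sub>1, k\<^sub>2\<close>.  If \<open>k\<^sub>2\<close> or \<open>k\<^sub>1 / k\<^sub>2\<close> is bounded, the constant signal \<open>\<rho>\<close>
  will do: either the damping \<open>\<rho> k\<^sub>2\<close> is bounded, or overdamping leaves a root of size about
  \<open>- k\<^sub>1 / k\<^sub>2\<close>.  Otherwise measure time in units of \<open>1 / \<kappa>\<close>, where
  \<open>\<kappa> = min (k\<^sub>1 / k\<^sub>2) (sqrt k\<^sub>1)\<close> is large, so that the force \<open>a x\<close> becomes negligible, and
  overshoot: from \<open>(x, v) = (0, 1)\<close> drift with \<open>\<alpha> = 0\<close> up to \<open>x = 100\<close>; a burst \<open>\<alpha> = 1\<close> of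
  length \<open>1 / 4\<close> then reverses the velocity to a value below \<open>- 2\<close>; drift again with \<open>\<alpha> = 0\<close>
  until \<open>x = 0\<close>, which happens with \<open>v \<le> - 1\<close>.  Repeating this cycle, \<open>x e + v b\<close> does not decay.
  The burst occupies a fixed fraction of the cycle, and the cycle is short compared with \<open>T\<close>.\<close>

section \<open>Second-order linear equations with constant coefficients\<close>

text \<open>An integrating factor: \<open>exp (q * s)\<close> turns the differential inequality into
  monotonicity. The sign of \<open>q\<close> stays open: \<open>-2\<close> serves for energy growth,
  \<open>0\<close> for displacements, and the friction coefficient for bounds on velocities.\<close>

lemma exp_weighted_decreasing:
  fixes h :: "real \<Rightarrow> real"
  assumes "0 \<le> t"
    and "\<And>s. 0 \<le> s \<Longrightarrow> s \<le> t \<Longrightarrow> (h has_real_derivative h' s) (at s)"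
    and "\<And>s. 0 \<le> s \<Longrightarrow> s \<le> t \<Longrightarrow> h' s + q * h s \<le> 0"
  shows "h t * exp (q * t) \<le> h 0"
proof -
  have "h t * exp (q * t) \<le> h 0 * exp (q * 0)"
  proof (rule DERIV_nonpos_imp_nonincreasing[OF assms(1)])
    fix s assume s: "0 \<le> s" "s \<le> t"
    have "((\<lambda>s. h s * exp (q * s)) has_real_derivative (h' s + q * h s) * exp (q * s)) (at s)"
      by (auto intro!: derivative_eq_intros assms(2) s simp: algebra_simps)
    moreover have "(h' s + q * h s) * exp (q * s) \<le> 0"
      using assms(3)[OF s] by (simp add: mult_nonpos_nonneg)
    ultimately show "\<exists>y. ((\<lambda>s. h s * exp (q * s)) has_real_derivative y) (at s) \<and> y \<le> 0"
      by blast
  qed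
  then show ?thesis by simp
qed

lemma nonpos_by_comparison:
  fixes h :: "real \<Rightarrow> real"
  assumes "0 \<le> t" "h 0 \<le> 0"
    and "\<And>s. 0 \<le> s \<Longrightarrow> s \<le> t \<Longrightarrow> (h has_real_derivative h' s) (at s)"
    and "\<And>s. 0 \<le> s \<Longrightarrow> s \<le> t \<Longrightarrow> h' s + q * h s \<le> 0"
  shows "h t \<le> 0"
proof -
  have "h t * exp (q * t) \<le> h 0" by (rule exp_weighted_decreasing[OF assms(1,3,4)])
  then have "h t * exp (q * t) \<le> 0" using assms(2) by simp
  then show ?thesis by (simp add: mult_le_0_iff not_le[symmetric])
qed

definition oscillator :: "real \<Rightarrow> real \<Rightarrow> (real \<Rightarrow> real) \<Rightarrow> (real \<Rightarrow> real) \<Rightarrow> bool" where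
  "oscillator P Q x v \<longleftrightarrow>
     (\<forall>t. (x has_real_derivative v t) (at t) \<and> (v has_real_derivative - (P * x t + Q * v t)) (at t))"

lemma oscillatorD:
  assumes "oscillator P Q x v"
  shows "(x has_real_derivative v t) (at t)"
    and "(v has_real_derivative - (P * x t + Q * v t)) (at t)"
  using assms by (auto simp: oscillator_def)

lemma oscillator_exp:
  assumes "r^2 + Q * r + P = 0"
  shows "oscillator P Q (\<lambda>t. exp (r * t)) (\<lambda>t. r * exp (r * t))"
proof -
  have "r * r = - (P + Q * r)" using assms by (simp add: power2_eq_square)
  then have "r * (r * exp (r * t)) = - (P * exp (r * t) + Q * (r * exp (r * t)))" for t
    by (metis (no_types, opaque_lifting) distrib_right minus_mult_left mult.assoc)
  then show ?thesis
    unfolding oscillator_def by (auto intro!: derivative_eq_intros simp: mult_ac)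
qed

text \<open>Splitting off \<open>exp (- Q / 2 * t)\<close> removes the friction term and leaves
  \<open>y'' = D * y\<close>, where \<open>D\<close> is a quarter of the discriminant of the
  characteristic polynomial. Its sign decides between affine, hyperbolic and trigonometric
  solutions.\<close>

lemma oscillator_gauge:
  assumes "\<And>t. (y has_real_derivative w t) (at t)"
    and "\<And>t. (w has_real_derivative D * y t) (at t)" and D: "D = Q^2 / 4 - P"
  shows "oscillator P Q (\<lambda>t. exp (- Q / 2 * t) * y t) (\<lambda>t. exp (- Q / 2 * t) * (w t - Q / 2 * y t))"
  unfolding oscillator_def
  by (auto intro!: derivative_eq_intros assms(1,2) simp: D power2_eq_square field_simps)

lemma oscillator_exists:
  "\<exists>x v. oscillator P Q x v \<and> x 0 = x0 \<and> v 0 = v0"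
proof -
  define D where "D = Q^2 / 4 - P"
  \<comment> \<open>The gauge lowers the initial velocity by \<open>Q / 2 * x0\<close>;
    \<open>w0\<close> compensates for this.\<close>
  define w0 where "w0 = v0 + Q / 2 * x0"
  have "\<exists>y w. (\<forall>t. (y has_real_derivative w t) (at t)) \<and> (\<forall>t. (w has_real_derivative D * y t) (at t))
          \<and> y 0 = x0 \<and> w 0 = w0"
  proof -
    consider "D = 0" | \<omega> where "\<omega> \<noteq> 0" "D = \<omega> * \<omega>" | \<omega> where "\<omega> \<noteq> 0" "D = - (\<omega> * \<omega>)"
    proof (cases D "0::real" rule: linorder_cases)
      case less
      then show ?thesis using that(3)[of "sqrt (- D)"] by auto
    next
      case greater
      then show ?thesis using that(2)[of "sqrt D"] by auto
    qed (use that in auto)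
    then show ?thesis
    proof cases
      case 1
      show ?thesis
        by (rule exI[of _ "\<lambda>t. x0 + w0 * t"], rule exI[of _ "\<lambda>t. w0"])
           (auto intro!: derivative_eq_intros simp: 1)
    next
      case 2
      show ?thesis
        by (rule exI[of _ "\<lambda>t. x0 * cosh (\<omega> * t) + w0 / \<omega> * sinh (\<omega> * t)"],
            rule exI[of _ "\<lambda>t. x0 * \<omega> * sinh (\<omega> * t) + w0 * cosh (\<omega> * t)"])
           (use 2 in \<open>auto intro!: derivative_eq_intros simp: algebra_simps\<close>)
    next
      case 3
      show ?thesis
        by (rule exI[of _ "\<lambda>t. x0 * cos (\<omega> * t) + w0 / \<omega> * sin (\<omega> * t)"],
            rule exI[of _ "\<lambda>t. - x0 * \<omega> * sin (\<omega> * t) + w0 * cos (\<omega> * t)"])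
           (use 3 in \<open>auto intro!: derivative_eq_intros simp: algebra_simps\<close>)
    qed
  qed
  then obtain y w where yw: "\<And>t. (y has_real_derivative w t) (at t)"
    "\<And>t. (w has_real_derivative D * y t) (at t)" "y 0 = x0" "w 0 = w0"
    by blast
  show ?thesis
    by (rule exI, rule exI, rule conjI[OF oscillator_gauge[OF yw(1,2) D_def]])
       (use yw(3,4) in \<open>simp add: w0_def\<close>)
qed

text \<open>During a drift the position grows at most exponentially, and a small enough
  \<open>a\<close> outweighs even \<open>exp 100\<close>, so the motion is almost uniform. The
  number 204 is the largest speed that a burst can leave behind, and 3000000 is the product of the
  position factor 300, the duration 100 and the reciprocal of the tolerance
  \<open>1 / 100\<close>.\<close>

lemma oscillator_weak_force:
  assumes osc: "oscillator a 0 x v" and a: "\<bar>a\<bar> * 3000000 * exp 100 \<le> 1"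
    and ini: "\<bar>x 0\<bar> \<le> 204" "\<bar>v 0\<bar> \<le> 204" and t: "0 \<le> t" "t \<le> 100"
  shows "\<bar>v t - v 0\<bar> \<le> 1 / 100"
proof -
  have exp1: "1 \<le> exp (100::real)" by simp
  have "\<bar>a\<bar> * 3000000 * 1 \<le> \<bar>a\<bar> * 3000000 * exp 100"
    by (intro mult_left_mono exp1) auto
  then have a1: "\<bar>a\<bar> \<le> 1" using a by linarith
  have xb: "\<bar>x s\<bar> \<le> 300 * exp 100" if s: "0 \<le> s" "s \<le> 100" for s
  proof -
    \<comment> \<open>The energy grows at most like \<open>exp (2 * s)\<close>, because its
      derivative is \<open>(1 - a) * (2 * x * v)\<close> and
      \<open>\<bar>1 - a\<bar> \<le> 2\<close>.\<close>
    have "((x s)^2 + (v s)^2) * exp ((-2) * s) \<le> (x 0)^2 + (v 0)^2"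
    proof (rule exp_weighted_decreasing[where h = "\<lambda>s. (x s)^2 + (v s)^2"
          and h' = "\<lambda>s. 2 * x s * v s + 2 * v s * (- (a * x s))"])
      fix r
      show "((\<lambda>s. (x s)\<^sup>2 + (v s)\<^sup>2) has_real_derivative 2 * x r * v r + 2 * v r * - (a * x r)) (at r)"
        using oscillatorD[OF osc, of r] by (auto intro!: derivative_eq_intros)
      have "2 * x r * v r + 2 * v r * - (a * x r) = (1 - a) * (2 * x r * v r)"
        by (simp add: algebra_simps)
      also have "\<dots> \<le> \<bar>1 - a\<bar> * \<bar>2 * x r * v r\<bar>"
        by (metis abs_ge_self abs_mult)
      also have "\<dots> \<le> 2 * ((x r)^2 + (v r)^2)"
      proof (rule mult_mono)
        have "0 \<le> (x r - v r)^2" "0 \<le> (x r + v r)^2" by auto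
        then show "\<bar>2 * x r * v r\<bar> \<le> (x r)\<^sup>2 + (v r)\<^sup>2"
          unfolding power2_eq_square by (auto simp: abs_le_iff algebra_simps)
      qed (use a1 in auto)
      finally show "2 * x r * v r + 2 * v r * - (a * x r) + - 2 * ((x r)\<^sup>2 + (v r)\<^sup>2) \<le> 0" by simp
    qed (use s in auto)
    also have "\<dots> \<le> 204^2 + 204^2"
      using ini abs_le_square_iff[of "x 0" 204] abs_le_square_iff[of "v 0" 204]
      by (intro add_mono) simp_all
    also have "\<dots> \<le> 300^2" by simp
    finally have *: "((x s)^2 + (v s)^2) * exp (- 2 * s) \<le> 300^2" .
    have "(x s)^2 * exp (- 2 * s) \<le> ((x s)^2 + (v s)^2) * exp (- 2 * s)"
      by (intro mult_right_mono) auto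
    with * have "(x s)^2 * exp (- 2 * s) \<le> 300^2" by linarith
    moreover have "exp (- 2 * s) = (exp (- s))^2" by (simp add: power2_eq_square flip: exp_add)
    ultimately have "(x s * exp (- s))^2 \<le> 300^2" by (simp add: power_mult_distrib)
    then have "\<bar>x s * exp (- s)\<bar> \<le> \<bar>300\<bar>" by (simp only: abs_le_square_iff)
    then have "\<bar>x s\<bar> \<le> 300 * exp s" by (simp add: abs_mult exp_minus field_simps)
    also have "\<dots> \<le> 300 * exp 100" using s by simp
    finally show ?thesis .
  qed
  have "norm (v t - v 0) \<le> (\<bar>a\<bar> * (300 * exp 100)) * norm (t - 0)"
  proof (rule field_differentiable_bound[where S = "{0..100}" and f' = "\<lambda>s. - (a * x s)"])
    fix s :: real assume s: "s \<in> {0..100}"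
    show "(v has_field_derivative - (a * x s)) (at s within {0..100})"
      using oscillatorD(2)[OF osc, of s] by (simp add: has_field_derivative_at_within)
    show "norm (- (a * x s)) \<le> \<bar>a\<bar> * (300 * exp 100)"
      using xb[of s] s by (auto simp: abs_mult intro!: mult_left_mono)
  qed (use t in auto)
  also have "\<dots> \<le> (\<bar>a\<bar> * (300 * exp 100)) * 100"
    using t by (intro mult_left_mono) auto
  also have "\<dots> \<le> 1 / 100" using a by simp
  finally show ?thesis by simp
qed

lemma oscillator_displacement:
  assumes osc: "oscillator P Q x v" and t: "0 \<le> t" and b: "\<And>s. 0 \<le> s \<Longrightarrow> s \<le> t \<Longrightarrow> c \<le> v s \<and> v s \<le> d"
  shows "x 0 + c * t \<le> x t" "x t \<le> x 0 + d * t"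
proof -
  have "(x 0 + c * t) - x t \<le> 0"
    by (rule nonpos_by_comparison[where h = "\<lambda>s. (x 0 + c * s) - x s" and h' = "\<lambda>s. c - v s" and q = 0])
       (use t b in \<open>auto intro!: derivative_eq_intros oscillatorD(1)[OF osc]\<close>)
  then show "x 0 + c * t \<le> x t" by simp
  have "x t - (x 0 + d * t) \<le> 0"
    by (rule nonpos_by_comparison[where h = "\<lambda>s. x s - (x 0 + d * s)" and h' = "\<lambda>s. v s - d" and q = 0])
       (use t b in \<open>auto intro!: derivative_eq_intros oscillatorD(1)[OF osc]\<close>)
  then show "x t \<le> x 0 + d * t" by simp
qed

text \<open>A bootstrap argument: an estimate that was derived under the provisional assumption
  \<open>0 \<le> g\<close> becomes unconditional. If \<open>g\<close> became negative it would have
  a first zero, and there the estimate gives \<open>c \<le> g\<close> with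
  \<open>0 < c\<close>.\<close>

lemma continuous_barrier:
  fixes g :: "real \<Rightarrow> real"
  assumes g: "continuous_on {0..T} g" "0 < c" "0 \<le> g 0"
    and step: "\<And>t. 0 \<le> t \<Longrightarrow> t \<le> T \<Longrightarrow> (\<And>s. 0 \<le> s \<Longrightarrow> s \<le> t \<Longrightarrow> 0 \<le> g s) \<Longrightarrow> c \<le> g t"
    and t: "0 \<le> t" "t \<le> T"
  shows "c \<le> g t"
proof -
  define Z where "Z = {0..T} \<inter> g -` {0}"
  have "0 \<le> g s" if s: "0 \<le> s" "s \<le> T" for s
  proof (rule ccontr)
    assume neg: "\<not> 0 \<le> g s"
    have "\<exists>r. 0 \<le> r \<and> r \<le> s \<and> g r = 0"
      using neg g(3) s by (intro IVT2') (auto intro: continuous_on_subset[OF g(1)])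
    then obtain r where "0 \<le> r" "r \<le> s" "g r = 0" by blast
    then have "r \<in> Z" using s by (simp add: Z_def)
    then have ne: "Z \<noteq> {}" by blast
    have "closed Z" unfolding Z_def by (rule continuous_closed_preimage[OF g(1)]) auto
    moreover have "bounded Z" by (rule bounded_subset[of "{0..T}"]) (auto simp: Z_def)
    ultimately have "compact Z" by (simp add: compact_eq_bounded_closed)
    then obtain z where z: "z \<in> Z" and least: "\<And>r. r \<in> Z \<Longrightarrow> z \<le> r"
      using compact_attains_inf[OF _ ne] by blast
    have "c \<le> g z"
    proof (rule step)
      fix r assume r: "0 \<le> r" "r \<le> z"
      show "0 \<le> g r"
      proof (rule ccontr)
        assume "\<not> 0 \<le> g r"
        then obtain r' where r': "0 \<le> r'" "r' \<le> r" "g r' = 0"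
          using IVT2'[of g r 0 0] g(3) r z
          by (force simp: Z_def intro: continuous_on_subset[OF g(1)])
        with r z have "r' \<in> Z" by (auto simp: Z_def)
        with least r' r have "r' = r" by force
        with r' \<open>\<not> 0 \<le> g r\<close> show False by simp
      qed
    qed (use z in \<open>auto simp: Z_def\<close>)
    with z g(2) show False by (simp add: Z_def)
  qed
  then show ?thesis using step t by auto
qed

text \<open>The last alternative is what bounds \<open>v\<close> from below: for \<open>P \<le> 2\<close> the force has no time to act,
  for \<open>P \<le> 2 * Q\<close> the friction stops \<open>v\<close> at \<open>-204\<close>.\<close>

lemma oscillator_reversal:
  assumes osc: "oscillator P Q x v"
    and PQ: "1 / 2 \<le> P" "0 \<le> Q" "Q \<le> 2 * P" "P \<le> 2 \<or> P \<le> 2 * Q"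
    and ini: "99 \<le> x 0" "x 0 \<le> 101" "1 / 2 \<le> v 0" "v 0 \<le> 2"
  shows "48 \<le> x (1 / 4)" "x (1 / 4) \<le> 102" "-204 \<le> v (1 / 4)" "v (1 / 4) \<le> -2"
proof -
  \<comment> \<open>All bounds rest provisionally on \<open>x\<close> being nonnegative up to time
    \<open>t\<close>; \<open>continuous_barrier\<close> discharges this below, since the bounds
    return \<open>48 \<le> x t\<close>.\<close>
  have bounds: "x t \<le> 102 \<and> -204 \<le> v t \<and> v t \<le> 2 \<and> 48 \<le> x t"
    if t: "0 \<le> t" "t \<le> 1 / 4" and pos: "\<And>s. 0 \<le> s \<Longrightarrow> s \<le> t \<Longrightarrow> 0 \<le> x s" for t
  proof -
    have v_le: "v s \<le> 2" if s: "0 \<le> s" "s \<le> t" for s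
    proof -
      \<comment> \<open>With the weight \<open>q = Q\<close> the friction term cancels against
        \<open>Q * v\<close>, so the comparison tolerates arbitrarily strong friction.\<close>
      have "v s - 2 \<le> 0"
      proof (rule nonpos_by_comparison[where h = "\<lambda>r. v r - 2" and h' = "\<lambda>r. - (P * x r + Q * v r)" and q = Q])
        fix r assume "0 \<le> r" "r \<le> s"
        then have "0 \<le> P * x r" using pos[of r] PQ s by auto
        then show "- (P * x r + Q * v r) + Q * (v r - 2) \<le> 0" using PQ by (simp add: algebra_simps)
      qed (use s ini in \<open>auto intro!: derivative_eq_intros oscillatorD(2)[OF osc]\<close>)
      then show ?thesis by simp
    qed
    have x_le: "x s \<le> 102" if s: "0 \<le> s" "s \<le> t" for s
    proof -
      have "x s - (x 0 + 2 * s) \<le> 0"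
        by (rule nonpos_by_comparison[where h = "\<lambda>s. x s - (x 0 + 2 * s)" and h' = "\<lambda>s. v s - 2" and q = 0])
           (use s v_le in \<open>auto intro!: derivative_eq_intros oscillatorD(1)[OF osc]\<close>)
      then show ?thesis using ini s t by linarith
    qed
    have v_ge: "-204 \<le> v s" if s: "0 \<le> s" "s \<le> t" for s
      using PQ(4)
    proof
      assume P2: "P \<le> 2"
      have "- v s - 204 * s \<le> 0"
      proof (rule nonpos_by_comparison[where h = "\<lambda>r. - v r - 204 * r"
            and h' = "\<lambda>r. (P * x r + Q * v r) - 204" and q = Q])
        fix r assume r: "0 \<le> r" "r \<le> s"
        have "P * x r \<le> 2 * 102" using P2 PQ x_le[of r] pos[of r] r s by (intro mult_mono) auto
        moreover have "0 \<le> Q * (204 * r)" using PQ r by auto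
        ultimately show "P * x r + Q * v r - 204 + Q * (- v r - 204 * r) \<le> 0"
          by (simp add: algebra_simps)
      qed (use s ini in \<open>auto intro!: derivative_eq_intros oscillatorD(2)[OF osc]\<close>)
      then show ?thesis using s t by linarith
    next
      assume PQ2: "P \<le> 2 * Q"
      have "- 204 - v s \<le> 0"
      proof (rule nonpos_by_comparison[where h = "\<lambda>r. - 204 - v r"
            and h' = "\<lambda>r. P * x r + Q * v r" and q = Q])
        fix r assume r: "0 \<le> r" "r \<le> s"
        have "P * x r \<le> (2 * Q) * 102" using PQ2 PQ x_le[of r] pos[of r] r s by (intro mult_mono) auto
        then show "P * x r + Q * v r + Q * (- 204 - v r) \<le> 0"
          by (simp add: algebra_simps)
      qed (use s ini in \<open>auto intro!: derivative_eq_intros oscillatorD(2)[OF osc]\<close>)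
      then show ?thesis by simp
    qed
    \<comment> \<open>Here \<open>99 - 204 / 4 = 48\<close>: the burst is too short for
      \<open>x\<close> to reach zero.\<close>
    have "x 0 + (-204) * t \<le> x t"
      using oscillator_displacement(1)[OF osc t(1), of "-204" 2] v_le v_ge by blast
    with t ini have "48 \<le> x t" by linarith
    with v_le v_ge x_le t show ?thesis by auto
  qed
  have x48: "48 \<le> x t" if "0 \<le> t" "t \<le> 1 / 4" for t
  proof (rule continuous_barrier[where T = "1/4" and g = x])
    show "continuous_on {0..1 / 4} x"
      using oscillatorD(1)[OF osc] by (meson DERIV_isCont continuous_at_imp_continuous_on)
  qed (use that bounds ini in auto)
  have "0 \<le> x t" if "0 \<le> t" "t \<le> 1 / 4" for t using x48[OF that] by simp
  then show "48 \<le> x (1 / 4)" "x (1 / 4) \<le> 102" "-204 \<le> v (1 / 4)"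
    using bounds[of "1/4"] by auto
  \<comment> \<open>The slope 16 takes the velocity bound from 2 to -2 within the burst. The
    comparison holds because \<open>x\<close> is at least 48 and \<open>Q \<le> 2 * P\<close>: its
    left side is at most \<open>16 - 48 * P + 2 * Q \<le> 16 - 44 * P\<close>, which is negative for
    \<open>1 / 2 \<le> P\<close>.\<close>
  have "v (1 / 4) - (2 - 16 * (1 / 4)) \<le> 0"
  proof (rule nonpos_by_comparison[where h = "\<lambda>r. v r - (2 - 16 * r)"
            and h' = "\<lambda>r. - (P * x r + Q * v r) + 16" and q = Q])
    fix r :: real assume r: "0 \<le> r" "r \<le> 1 / 4"
    have "P * 48 \<le> P * x r" using x48[OF r] PQ by (intro mult_left_mono) auto
    moreover have "- Q * (2 - 16 * r) \<le> Q * 2"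
      using PQ r mult_left_mono[of "16 * r - 2" 2 Q] by (simp add: algebra_simps)
    moreover have "- (P * x r + Q * v r) + 16 + Q * (v r - (2 - 16 * r)) =
        16 - P * x r + (- Q) * (2 - 16 * r)" by (simp add: algebra_simps)
    ultimately show "- (P * x r + Q * v r) + 16 + Q * (v r - (2 - 16 * r)) \<le> 0"
      using PQ(1,3) by linarith
  qed (use ini in \<open>auto intro!: derivative_eq_intros oscillatorD(2)[OF osc]\<close>)
  then show "v (1 / 4) \<le> -2" by simp
qed

section \<open>Trajectories of the switched system\<close>

text \<open>An arc of a trajectory, in the same integral form as \<open>solution\<close>. Naming
  both end states lets arcs be glued, rescaled by linearity and translated by periods of the
  signal.\<close>

definition reach ::
  "real^'n^'n \<Rightarrow> real^'n \<Rightarrow> real^'n \<Rightarrow> (real \<Rightarrow> real) \<Rightarrow> real \<Rightarrow> real \<Rightarrow> real^'n \<Rightarrow> real^'n \<Rightarrow> (real \<Rightarrow> real^'n) \<Rightarrow> bool"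
  where
  "reach A b K \<alpha> s t p q z \<longleftrightarrow> z s = p \<and> z t = q \<and>
     (\<forall>u\<in>{s..t}. ((\<lambda>r. closed_loop A b K (\<alpha> r) *v z r) has_integral (z u - p)) {s..u})"

lemma reach_trans:
  assumes r1: "reach A b K \<alpha> s t p q z" and r2: "reach A b K \<alpha> t u q r y" and "s \<le> t" "t \<le> u"
  shows "reach A b K \<alpha> s u p r (\<lambda>\<tau>. if \<tau> < t then z \<tau> else y \<tau>)"
proof -
  let ?w = "\<lambda>\<tau>. if \<tau> < t then z \<tau> else y \<tau>"
  let ?f = "\<lambda>z r. closed_loop A b K (\<alpha> r) *v z r"
  have zt: "z s = p" "z t = q" "y t = q" "y u = r" using r1 r2 by (auto simp: reach_def)
  have i1: "(?f ?w has_integral (z v - p)) {s..v}" if "v \<in> {s..t}" for v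
  proof (rule has_integral_spike_finite[of "{t}" _ _ "?f z"])
    show "(?f z has_integral (z v - p)) {s..v}" using r1 that by (auto simp: reach_def)
  qed (use that in auto)
  have i2: "(?f ?w has_integral (y v - q)) {t..v}" if "v \<in> {t..u}" for v
  proof (rule has_integral_spike_finite[of "{}" _ _ "?f y"])
    show "(?f y has_integral (y v - q)) {t..v}" using r2 that by (auto simp: reach_def)
  qed auto
  have "(?f ?w has_integral (?w v - p)) {s..v}" if v: "v \<in> {s..u}" for v
  proof (cases "v < t")
    case True
    then show ?thesis using i1[of v] v by simp
  next
    case False
    then have "(?f ?w has_integral ((z t - p) + (y v - q))) {s..v}"
      using v assms(3) by (intro has_integral_combine[of s t v] i1 i2) auto
    then show ?thesis using False zt by simp
  qed
  moreover have "?w s = p" "?w u = r" using zt assms(3,4) by auto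
  ultimately show ?thesis unfolding reach_def by blast
qed

lemma reach_scaleR:
  assumes "reach A b K \<alpha> s t p q z"
  shows "reach A b K \<alpha> s t (c *\<^sub>R p) (c *\<^sub>R q) (\<lambda>r. c *\<^sub>R z r)"
  using assms unfolding reach_def
  by (auto simp: matrix_vector_mult_scaleR simp flip: scaleR_diff_right intro!: has_integral_cmul)

lemma reach_shift:
  assumes r: "reach A b K \<alpha> s t p q z" and per: "\<And>r. \<alpha> (r - P) = \<alpha> r"
  shows "reach A b K \<alpha> (s + P) (t + P) p q (\<lambda>r. z (r - P))"
  unfolding reach_def
proof (intro conjI ballI)
  fix u assume u: "u \<in> {s + P..t + P}"
  have "((\<lambda>r. closed_loop A b K (\<alpha> r) *v z r) has_integral (z (u - P) - p)) (cbox s (u - P))"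
    using r u by (auto simp: reach_def)
  from has_integral_affinity[OF this, of 1 "- P"]
  show "((\<lambda>r. closed_loop A b K (\<alpha> r) *v z (r - P)) has_integral (z (u - P) - p)) {s + P..u}"
    using u by (simp add: per add.commute)
qed (use r in \<open>auto simp: reach_def\<close>)

lemma periodic_shift:
  fixes \<alpha> :: "real \<Rightarrow> 'a"
  assumes "\<And>r. \<alpha> (r - P) = \<alpha> r"
  shows "\<alpha> (r - real n * P) = \<alpha> r"
proof (induction n)
  case (Suc n)
  then show ?case using assms[of "r - real n * P"] by (simp add: algebra_simps)
qed simp

text \<open>Floquet's principle: \<open>p\<close> is an eigenvector of the period map with
  multiplier \<open>\<mu>\<close>, so the arc over the \<open>n\<close>-th period is the first arc,
  translated and multiplied by \<open>\<mu> ^ n\<close>.\<close>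

lemma reach_iterate:
  assumes r: "reach A b K \<alpha> 0 P p (\<mu> *\<^sub>R p) z" and per: "\<And>r. \<alpha> (r - P) = \<alpha> r" and P: "0 < P"
  defines "w \<equiv> \<lambda>t. \<mu> ^ nat \<lfloor>t / P\<rfloor> *\<^sub>R z (t - of_int \<lfloor>t / P\<rfloor> * P)"
  shows "solution A b K \<alpha> p w" and "w (real n * P) = \<mu> ^ n *\<^sub>R p"
proof -
  let ?f = "\<lambda>r. closed_loop A b K (\<alpha> r) *v w r"
  have z0: "z 0 = p" using r by (simp add: reach_def)
  show w_end: "w (real n * P) = \<mu> ^ n *\<^sub>R p" for n
    using P z0 by (simp add: w_def)
  have w_in: "w t = \<mu> ^ n *\<^sub>R z (t - real n * P)" if "real n * P \<le> t" "t < real (Suc n) * P" for t n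
  proof -
    have "real n \<le> t / P" "t / P < real n + 1"
      using that P by (auto simp: field_simps)
    then have "\<lfloor>t / P\<rfloor> = int n" by (simp add: floor_eq_iff)
    then show ?thesis by (simp add: w_def)
  qed
  have piece: "(?f has_integral (w t - w (real n * P))) {real n * P..t}"
    if t: "real n * P \<le> t" "t \<le> real (Suc n) * P" for t n
  proof -
    let ?z = "\<lambda>r. \<mu> ^ n *\<^sub>R z (r - real n * P)"
    have "reach A b K \<alpha> (0 + real n * P) (P + real n * P) (\<mu> ^ n *\<^sub>R p) (\<mu> ^ n *\<^sub>R \<mu> *\<^sub>R p) ?z"
      by (rule reach_scaleR[OF reach_shift[OF r periodic_shift[of \<alpha>, OF per]]])
    then have R: "?z (real (Suc n) * P) = \<mu> ^ Suc n *\<^sub>R p"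
      "((\<lambda>r. closed_loop A b K (\<alpha> r) *v ?z r) has_integral (?z t - \<mu> ^ n *\<^sub>R p)) {real n * P..t}"
      using t by (auto simp: reach_def algebra_simps)
    \<comment> \<open>At the right end of a period the floor in \<open>w\<close> has already jumped,
      hence the exceptional point. The values still agree there because
      \<open>z P = \<mu> *\<^sub>R z 0\<close>.\<close>
    have "(?f has_integral (?z t - \<mu> ^ n *\<^sub>R p)) {real n * P..t}"
      by (rule has_integral_spike_finite[OF _ _ R(2), of "{real (Suc n) * P}"])
         (use t w_in in auto)
    moreover have "w t = ?z t"
      using w_in[of n t] R(1) w_end[of "Suc n"] t by (cases "t < real (Suc n) * P") auto
    ultimately show ?thesis by (simp add: w_end)
  qed
  have whole: "(?f has_integral (w (real n * P) - p)) {0..real n * P}" for n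
  proof (induction n)
    case (Suc n)
    have "(?f has_integral ((w (real n * P) - p) + (w (real (Suc n) * P) - w (real n * P)))) {0..real (Suc n) * P}"
      by (rule has_integral_combine[OF _ _ Suc piece]) (use P in auto)
    then show ?case by simp
  qed (use w_end[of 0] has_integral_refl in simp)
  show "solution A b K \<alpha> p w"
    unfolding solution_def
  proof (intro allI impI)
    fix t :: real assume t: "0 \<le> t"
    define n where "n = nat \<lfloor>t / P\<rfloor>"
    have "real n \<le> t / P" "t / P \<le> real (Suc n)"
      using t P by (auto simp: n_def) linarith
    then have n: "real n * P \<le> t" "t \<le> real (Suc n) * P" using P by (auto simp: field_simps)
    have "(?f has_integral ((w (real n * P) - p) + (w t - w (real n * P)))) {0..t}"
      by (rule has_integral_combine[OF _ _ whole piece]) (use P n in auto)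
    then show "(?f has_integral (w t - p)) {0..t}" by simp
  qed
qed

lemma lyap_max_ge:
  assumes r: "reach A b K \<alpha> 0 P p (\<mu> *\<^sub>R p) z" and per: "\<And>r. \<alpha> (r - P) = \<alpha> r"
    and P: "0 < P" and p: "p \<noteq> 0" and \<mu>: "exp (c * P) \<le> \<bar>\<mu>\<bar>"
  shows "ereal c \<le> lyap_max A b K \<alpha>"
proof -
  let ?p = "inverse (norm p) *\<^sub>R p"
  have "reach A b K \<alpha> 0 P ?p (\<mu> *\<^sub>R ?p) (\<lambda>t. inverse (norm p) *\<^sub>R z t)"
    using reach_scaleR[OF r, of "inverse (norm p)"] by (simp add: mult.commute)
  from reach_iterate[OF this per P] obtain w
    where w: "solution A b K \<alpha> ?p w" "\<And>n. w (real n * P) = \<mu> ^ n *\<^sub>R ?p" by blast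
  have np: "norm ?p = 1" using p by simp
  have "ereal c \<le> Limsup at_top (\<lambda>t. ereal (ln (norm (w t)) / t))"
    unfolding Limsup_def
  proof (rule INF_greatest)
    fix Q assume "Q \<in> {Q. eventually Q (at_top :: real filter)}"
    then obtain N where N: "\<And>t. N \<le> t \<Longrightarrow> Q t" by (auto simp: eventually_at_top_linorder)
    \<comment> \<open>Beyond \<open>N\<close> the predicate \<open>Q\<close> holds; beyond 1 the
      sampling time is positive and can serve as a divisor.\<close>
    obtain n where n: "max N 1 / P < real n" using reals_Archimedean2 by blast
    then have n': "max N 1 < real n * P" using P by (simp add: field_simps)
    then have n0: "0 < real n * P" by linarith
    have "exp (c * (real n * P)) = exp (c * P) ^ n"
      by (simp add: mult_ac flip: exp_of_nat_mult)
    also have "\<dots> \<le> \<bar>\<mu>\<bar> ^ n" using \<mu> by (intro power_mono) auto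
    also have "\<dots> = norm (w (real n * P))" by (simp only: w(2) norm_scaleR[of _ ?p] np power_abs mult_1_right)
    finally have "exp (c * (real n * P)) \<le> norm (w (real n * P))" .
    then have "c * (real n * P) \<le> ln (norm (w (real n * P)))"
      using exp_gt_zero[of "c * (real n * P)"] by (subst ln_ge_iff) linarith+
    then have "c \<le> ln (norm (w (real n * P))) / (real n * P)"
      using n0 by (simp add: pos_le_divide_eq)
    then have "ereal c \<le> ereal (ln (norm (w (real n * P))) / (real n * P))" by simp
    also have "\<dots> \<le> (SUP t\<in>Collect Q. ereal (ln (norm (w t)) / t))"
      using N[of "real n * P"] n' by (intro SUP_upper) auto
    finally show "ereal c \<le> (SUP t\<in>Collect Q. ereal (ln (norm (w t)) / t))" .
  qed
  also have "\<dots> \<le> lyap_max A b K \<alpha>"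
    unfolding lyap_max_def using np w(1) by (intro SUP_upper2[of "(?p, w)"]) auto
  finally show ?thesis .
qed

section \<open>From oscillators to arcs of the closed-loop system\<close>

lemma closed_loop_apply:
  fixes A :: "real^'n^'n"
  shows
  "closed_loop A b K c *v x = A *v x - (c * (K \<bullet> x)) *\<^sub>R b"
proof -
  have "(c *\<^sub>R ((columnvector b :: real^1^'n) ** (rowvector K :: real^'n^1))) *v x = (c * (K \<bullet> x)) *\<^sub>R b"
    by (simp add: vec_eq_iff matrix_vector_mult_def matrix_matrix_mult_def columnvector_def
        rowvector_def inner_vec_def sum_distrib_left mult_ac)
  then show ?thesis by (simp add: closed_loop_def matrix_vector_mult_diff_rdistrib)
qed

text \<open>Both \<open>e\<close> and \<open>b\<close> carry the common growth
  \<open>\<sigma>\<close>, which factors out as an exponential. Measuring time in units of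
  \<open>1 / \<kappa>\<close> divides the stiffness by \<open>\<kappa>^2\<close> and the friction by
  \<open>\<kappa>\<close>, and puts the factor \<open>\<kappa>\<close> in front of the
  velocity.\<close>

lemma oscillator_reach:
  fixes A :: "real^'n^'n"
  assumes Ab: "A *v b = e + \<sigma> *\<^sub>R b" and Ae: "A *v e = \<sigma> *\<^sub>R e + a *\<^sub>R b"
    and \<kappa>: "0 < \<kappa>" and osc: "oscillator ((c * (K \<bullet> e) - a) / \<kappa>^2) (c * (K \<bullet> b) / \<kappa>) x v"
    and \<alpha>: "\<And>r. s \<le> r \<Longrightarrow> r < s + d / \<kappa> \<Longrightarrow> \<alpha> r = c" and d: "0 \<le> d"
  shows "\<exists>z. reach A b K \<alpha> s (s + d / \<kappa>) (x 0 *\<^sub>R e + (\<kappa> * v 0) *\<^sub>R b)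
           (exp (\<sigma> * d / \<kappa>) *\<^sub>R (x d *\<^sub>R e + (\<kappa> * v d) *\<^sub>R b)) z"
proof -
  define z where "z t = exp (\<sigma> * (t - s)) *\<^sub>R (x (\<kappa> * (t - s)) *\<^sub>R e + (\<kappa> * v (\<kappa> * (t - s))) *\<^sub>R b)" for t
  have deriv: "(z has_vector_derivative closed_loop A b K c *v z t) (at t)" for t
  proof -
    let ?X = "x (\<kappa> * (t - s))" and ?V = "v (\<kappa> * (t - s))" and ?E = "exp (\<sigma> * (t - s))"
    let ?W = "- ((c * (K \<bullet> e) - a) / \<kappa>^2 * ?X + c * (K \<bullet> b) / \<kappa> * ?V)"
    have lin: "((\<lambda>t. \<kappa> * (t - s)) has_real_derivative \<kappa>) (at t)"
      by (auto intro!: derivative_eq_intros)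
    have X: "((\<lambda>t. x (\<kappa> * (t - s))) has_real_derivative ?V * \<kappa>) (at t)"
      by (rule DERIV_chain2[OF oscillatorD(1)[OF osc] lin])
    have V: "((\<lambda>t. v (\<kappa> * (t - s))) has_real_derivative ?W * \<kappa>) (at t)"
      by (rule DERIV_chain2[OF oscillatorD(2)[OF osc] lin])
    have E: "((\<lambda>t. exp (\<sigma> * (t - s))) has_real_derivative \<sigma> * ?E) (at t)"
      by (auto intro!: derivative_eq_intros)
    have z_eq: "z = (\<lambda>t. (exp (\<sigma> * (t - s)) * x (\<kappa> * (t - s))) *\<^sub>R e
        + (\<kappa> * (exp (\<sigma> * (t - s)) * v (\<kappa> * (t - s)))) *\<^sub>R b)"
      by (simp add: z_def fun_eq_iff scaleR_add_right mult_ac)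
    have scaled: "((\<lambda>t. f t *\<^sub>R y) has_vector_derivative f' *\<^sub>R y) (at t)"
      if "(f has_real_derivative f') (at t)" for f f' and y :: "real^'n"
      using has_vector_derivative_scaleR[OF that has_vector_derivative_const[of y "at t"]] by simp
    have regroup: "((\<sigma> * E) * X + (V * \<kappa>) * E) *\<^sub>R e + (\<kappa> * ((\<sigma> * E) * V + (W * \<kappa>) * E)) *\<^sub>R b
        = E *\<^sub>R ((V * \<kappa>) *\<^sub>R e + (\<kappa> * (W * \<kappa>)) *\<^sub>R b) + (\<sigma> * E) *\<^sub>R (X *\<^sub>R e + (\<kappa> * V) *\<^sub>R b)"
      for E X V W :: real
      by (simp add: algebra_simps)
    have "(z has_vector_derivative
        ((\<sigma> * ?E) * ?X + (?V * \<kappa>) * ?E) *\<^sub>R e + (\<kappa> * ((\<sigma> * ?E) * ?V + (?W * \<kappa>) * ?E)) *\<^sub>R b) (at t)"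
      unfolding z_eq
      by (intro has_vector_derivative_add scaled DERIV_cmult DERIV_mult E X V)
    then have "(z has_vector_derivative
        ?E *\<^sub>R ((?V * \<kappa>) *\<^sub>R e + (\<kappa> * (?W * \<kappa>)) *\<^sub>R b) + (\<sigma> * ?E) *\<^sub>R (?X *\<^sub>R e + (\<kappa> * ?V) *\<^sub>R b)) (at t)"
      unfolding regroup .
    moreover have "\<kappa> * (?W * \<kappa>) = a * ?X - c * (?X * (K \<bullet> e) + \<kappa> * ?V * (K \<bullet> b))"
      using \<kappa> by (simp add: divide_simps) (simp add: algebra_simps power2_eq_square)
    moreover have "closed_loop A b K c *v z t =
        ?E *\<^sub>R ((?V * \<kappa>) *\<^sub>R e + (a * ?X - c * (?X * (K \<bullet> e) + \<kappa> * ?V * (K \<bullet> b))) *\<^sub>R b)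
        + (\<sigma> * ?E) *\<^sub>R (?X *\<^sub>R e + (\<kappa> * ?V) *\<^sub>R b)"
      by (simp add: z_def closed_loop_apply matrix_vector_mult_scaleR matrix_vector_right_distrib Ab Ae
          inner_add_right scaleR_add_right scaleR_add_left scaleR_diff_left scaleR_diff_right
          distrib_left right_diff_distrib mult_ac)
    ultimately show ?thesis by simp
  qed
  \<comment> \<open>The signal may already have switched at the final instant; a single point does
    not affect the integral.\<close>
  have integral: "((\<lambda>r. closed_loop A b K (\<alpha> r) *v z r) has_integral (z u - z s)) {s..u}"
    if u: "u \<in> {s..s + d / \<kappa>}" for u
  proof (rule has_integral_spike_finite[of "{s + d / \<kappa>}"])
    show "((\<lambda>r. closed_loop A b K c *v z r) has_integral (z u - z s)) {s..u}"
      using u by (intro fundamental_theorem_of_calculus)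
        (auto intro: has_vector_derivative_at_within deriv)
  qed (use u \<alpha> in auto)
  have z_s: "z s = x 0 *\<^sub>R e + (\<kappa> * v 0) *\<^sub>R b" by (simp add: z_def)
  have z_end: "z (s + d / \<kappa>) = exp (\<sigma> * d / \<kappa>) *\<^sub>R (x d *\<^sub>R e + (\<kappa> * v d) *\<^sub>R b)"
    using \<kappa> by (simp add: z_def)
  show ?thesis
    unfolding reach_def by (intro exI[of _ z] conjI ballI z_s z_end) (simp add: integral flip: z_s)
qed

section \<open>Persistently exciting signals\<close>

definition pulse :: "real \<Rightarrow> real \<Rightarrow> real \<Rightarrow> real \<Rightarrow> real" where
  "pulse P l u t = indicator {l..<u} (t - of_int \<lfloor>t / P\<rfloor> * P)"

lemma pulse_periodic: "0 < P \<Longrightarrow> pulse P l u (t - P) = pulse P l u t"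
  by (simp add: pulse_def diff_divide_distrib algebra_simps)

lemma pulse_on_period:
  assumes "real n * P \<le> t" "t < real (Suc n) * P" "0 < P"
  shows "pulse P l u t = indicator {l..<u} (t - real n * P)"
proof -
  have "real n \<le> t / P" "t / P < real n + 1" using assms by (auto simp: field_simps)
  then have "\<lfloor>t / P\<rfloor> = int n" by (simp add: floor_eq_iff)
  then show ?thesis by (simp add: pulse_def)
qed

lemma pulse_measurable: "pulse P l u \<in> borel_measurable (lebesgue_on S)"
proof -
  have "(\<lambda>t::real. real_of_int \<lfloor>t / P\<rfloor>) \<in> borel_measurable borel"
    by (rule measurable_compose[OF _ borel_measurable_real_floor]) simp
  then have "(\<lambda>t. t - real_of_int \<lfloor>t / P\<rfloor> * P) \<in> borel_measurable borel"
    by simp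
  then have "(\<lambda>t. indicator {l..<u} (t - real_of_int \<lfloor>t / P\<rfloor> * P) :: real) \<in> borel_measurable borel"
    by (rule measurable_compose) simp
  then have "pulse P l u \<in> borel_measurable borel" by (simp add: pulse_def[abs_def])
  then have "pulse P l u \<in> borel_measurable lebesgue" by (simp add: measurable_completion)
  then show ?thesis by (rule measurable_restrict_space1)
qed

lemma pulse_integrable: "pulse P l u integrable_on {s..t}"
proof (rule measurable_bounded_by_integrable_imp_integrable[OF pulse_measurable])
  show "(\<lambda>_. 1::real) integrable_on {s..t}" by (rule integrable_const_ivl)
qed (auto simp: pulse_def indicator_def)

lemma pulse_integral_period:
  assumes P: "0 < P" and lu: "0 \<le> l" "l \<le> u" "u \<le> P"
  shows "u - l \<le> integral {real n * P..real (Suc n) * P} (pulse P l u)"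
proof -
  have "((\<lambda>_. 1::real) has_integral (u - l)) {real n * P + l..real n * P + u}"
    using has_integral_const_real[of "1::real" "real n * P + l" "real n * P + u"] lu by simp
  then have "(pulse P l u has_integral (u - l)) {real n * P + l..real n * P + u}"
  proof (rule has_integral_spike_finite[rotated 2])
    fix t assume t: "t \<in> {real n * P + l..real n * P + u} - {real n * P + u}"
    then show "pulse P l u t = 1"
      using lu P by (subst pulse_on_period[of n]) (auto simp: algebra_simps)
  qed simp
  then have "u - l = integral {real n * P + l..real n * P + u} (pulse P l u)"
    by (rule integral_unique[symmetric])
  also have "\<dots> \<le> integral {real n * P..real (Suc n) * P} (pulse P l u)"
    using lu P by (intro integral_subset_le pulse_integrable) (auto simp: pulse_def algebra_simps)
  finally show ?thesis .
qed

lemma pulse_integral_periods: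
  assumes P: "0 < P" and lu: "0 \<le> l" "l \<le> u" "u \<le> P"
  shows "real k * (u - l) \<le> integral {real n * P..real (n + k) * P} (pulse P l u)"
proof (induction k)
  case (Suc k)
  have "integral {real n * P..real (n + k) * P} (pulse P l u)
      + integral {real (n + k) * P..real (Suc (n + k)) * P} (pulse P l u)
      = integral {real n * P..real (Suc (n + k)) * P} (pulse P l u)"
    using P by (intro Henstock_Kurzweil_Integration.integral_combine pulse_integrable) auto
  with Suc pulse_integral_period[OF assms, of "n + k"] show ?case
    by (simp add: algebra_simps)
qed simp

text \<open>A window of length \<open>T\<close> contains at least \<open>T / P - 2\<close> complete
  periods, which is at least \<open>T / (2 * P)\<close> because \<open>4 * P \<le> T\<close>. Each
  contributes at least \<open>2 * \<rho> * P\<close>; the factor 2 pays for the incomplete periods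
  at both ends.\<close>

lemma pulse_PE:
  assumes P: "0 < P" "4 * P \<le> T" and lu: "0 \<le> l" "l \<le> u" "u \<le> P" and \<rho>: "2 * \<rho> * P \<le> u - l"
  shows "pulse P l u \<in> PE T (\<rho> * T)"
proof -
  have "\<rho> * T \<le> integral {t..t + T} (pulse P l u)" if t: "0 \<le> t" for t
  proof -
    define n where "n = nat \<lceil>t / P\<rceil>"
    define m where "m = nat \<lfloor>(t + T) / P\<rfloor>"
    have tP: "0 \<le> t / P" "0 \<le> (t + T) / P" using t P by auto
    have n: "t / P \<le> real n" "real n \<le> t / P + 1"
      using tP by (auto simp: n_def)
    have m: "real m \<le> (t + T) / P" "(t + T) / P \<le> real m + 1"
      using tP by (auto simp: m_def)
    define k0 where "k0 = T / P / 2"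
    have TP: "2 \<le> k0" using P by (simp add: k0_def field_simps)
    have mn: "k0 \<le> real m - real n"
      using n m TP by (simp add: k0_def add_divide_distrib)
    then have "real n \<le> real m" using TP by linarith
    then have "n \<le> m" by simp
    then obtain k where k: "m = n + k" by (auto simp: le_iff_add)
    have "\<rho> * T = (2 * \<rho> * P) * k0" using P by (simp add: k0_def)
    also have "\<dots> \<le> (u - l) * k0" using \<rho> TP by (intro mult_right_mono) auto
    also have "\<dots> \<le> (u - l) * real k" using mn lu by (intro mult_left_mono) (auto simp: k)
    also have "\<dots> \<le> integral {real n * P..real m * P} (pulse P l u)"
      using pulse_integral_periods[OF P(1) lu, of k n] by (simp add: k mult.commute)
    also have "\<dots> \<le> integral {t..t + T} (pulse P l u)"
      using n(1) m(1) P by (intro integral_subset_le pulse_integrable) (auto simp: pulse_def field_simps)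
    finally show ?thesis .
  qed
  then show ?thesis
    by (auto simp: PE_def pulse_measurable pulse_def indicator_def)
qed

lemma const_PE:
  assumes "0 \<le> \<rho>" "\<rho> \<le> 1" "0 \<le> T"
  shows "(\<lambda>_. \<rho>) \<in> PE T (\<rho> * T)"
  using assms by (simp add: PE_def mult.commute)

section \<open>Slowly decaying trajectories\<close>

text \<open>Real characteristic roots: the larger root \<open>r\<close> gives the eigenvector
  \<open>e + r *\<^sub>R b\<close> with exponent \<open>\<sigma> + r\<close>, and \<open>r\<close>
  is at least \<open>- C\<close>. Complex roots: the decay rate relative to \<open>\<sigma>\<close>
  is \<open>Q / 2\<close>, which is at most \<open>C\<close>.\<close>

lemma constant_gain_lyap_max:
  fixes A :: "real^'n^'n"
  assumes Ab: "A *v b = e + \<sigma> *\<^sub>R b" and Ae: "A *v e = \<sigma> *\<^sub>R e + a *\<^sub>R b"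
    and ind: "\<And>r. e + r *\<^sub>R b \<noteq> 0" and b: "b \<noteq> 0" and \<rho>: "0 \<le> \<rho>" "\<rho> \<le> 1"
    and N: "0 \<le> N" "K \<bullet> b \<le> N \<or> K \<bullet> e \<le> N * (K \<bullet> b)"
  shows "ereal (\<sigma> - (4 * N + 2 * \<bar>a\<bar> + 2)) \<le> lyap_max A b K (\<lambda>_. \<rho>)"
proof -
  define C where "C = 4 * N + 2 * \<bar>a\<bar> + 2"
  define P where "P = (\<rho> * (K \<bullet> e) - a) / 1^2"
  define Q where "Q = \<rho> * (K \<bullet> b) / 1"
  have C: "2 \<le> C" "4 * N \<le> C" "2 * \<bar>a\<bar> \<le> C" using N by (auto simp: C_def)
  note reach = oscillator_reach[OF Ab Ae zero_less_one, where K = K and \<alpha> = "\<lambda>_. \<rho>" and c = \<rho> and s = 0,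
      folded P_def Q_def, OF _ refl]
  \<comment> \<open>Strong damping rules out the first alternative in the assumption on
    \<open>K\<close>, so the second one bounds the stiffness linearly in the damping.\<close>
  have large_damping: "P \<le> N * Q + \<bar>a\<bar>" if "2 * C < Q"
  proof -
    have "\<not> K \<bullet> b \<le> N"
    proof
      assume "K \<bullet> b \<le> N"
      then have "Q \<le> \<rho> * N" using \<rho> by (simp add: Q_def mult_left_mono)
      also have "\<dots> \<le> N" using \<rho> N(1) by (simp add: mult_left_le_one_le)
      finally show False using that C N(1) by linarith
    qed
    with N(2) have "\<rho> * (K \<bullet> e) \<le> \<rho> * (N * (K \<bullet> b))" using \<rho> by (intro mult_left_mono) auto
    then show ?thesis by (simp add: P_def Q_def algebra_simps)
  qed
  show ?thesis
  proof (cases "P \<le> Q^2 / 4")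
    case True
    define w where "w = sqrt (Q^2 / 4 - P)"
    define r where "r = - Q / 2 + w"
    have w: "w^2 = Q^2 / 4 - P" "0 \<le> w" using True by (auto simp: w_def)
    have root: "r^2 + Q * r + P = 0"
      using w(1) by (simp add: r_def power2_eq_square algebra_simps)
    have "- C \<le> r"
    proof (cases "Q \<le> 2 * C")
      case True
      then show ?thesis using w(2) by (simp add: r_def)
    next
      case False
      then have Q: "2 * C < Q" by simp
      \<comment> \<open>The aim is that the characteristic polynomial is nonpositive at
        \<open>- C\<close>, which puts \<open>- C\<close> between the two roots and thus below the
        larger one. From \<open>4 * N \<le> C\<close> one gets
        \<open>3 / 4 * C \<le> C - N\<close>.\<close>
      have "(3 / 4 * C) * (2 * C) \<le> (C - N) * Q"
        using C N(1) Q by (intro mult_mono) auto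
      moreover have "2 * \<bar>a\<bar> \<le> C * C" using C mult_mono[of 1 C "2 * \<bar>a\<bar>" C] by auto
      ultimately have "C * C - Q * C + P \<le> 0"
        using large_damping[OF Q] by (simp add: algebra_simps)
      moreover have "(Q / 2 - C)^2 = Q^2 / 4 - Q * C + C * C"
        by (simp add: power2_eq_square algebra_simps)
      ultimately have "(Q / 2 - C)^2 \<le> w^2" using w(1) by linarith
      then have "Q / 2 - C \<le> w" using w(2) by (rule power2_le_imp_le)
      then show ?thesis by (simp add: r_def)
    qed
    have "\<exists>z. reach A b K (\<lambda>_. \<rho>) 0 1 (e + r *\<^sub>R b) (exp (\<sigma> + r) *\<^sub>R (e + r *\<^sub>R b)) z"
      using reach[OF oscillator_exp[OF root], of 1] by (simp add: exp_add algebra_simps)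
    then obtain z where "reach A b K (\<lambda>_. \<rho>) 0 1 (e + r *\<^sub>R b) (exp (\<sigma> + r) *\<^sub>R (e + r *\<^sub>R b)) z" ..
    then show ?thesis
      by (rule lyap_max_ge) (use \<open>- C \<le> r\<close> ind in \<open>auto simp: C_def\<close>)
  next
    case False
    define \<omega> where "\<omega> = sqrt (P - Q^2 / 4)"
    have \<omega>: "0 < \<omega>" "\<omega> * \<omega> = P - Q^2 / 4" using False by (auto simp: \<omega>_def)
    \<comment> \<open>Stronger damping would give
      \<open>P \<le> N * Q + \<bar>a\<bar> \<le> C * Q / 2 \<le> Q^2 / 4\<close>, that is, real
      roots.\<close>
    have "Q \<le> 2 * C"
    proof (rule ccontr)
      assume "\<not> Q \<le> 2 * C"
      then have Q: "2 * C < Q" by simp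
      have "(2 * C) * Q \<le> Q * Q" using Q C by (intro mult_right_mono) auto
      moreover have "(4 * N) * Q \<le> C * Q" using Q C by (intro mult_right_mono) auto
      moreover have "2 * (2 * \<bar>a\<bar>) \<le> C * Q" using Q C by (intro mult_mono) auto
      ultimately show False
        using large_damping[OF Q] False by (simp add: power2_eq_square)
    qed
    have osc: "oscillator P Q (\<lambda>t. exp (- Q / 2 * t) * sin (\<omega> * t))
        (\<lambda>t. exp (- Q / 2 * t) * (\<omega> * cos (\<omega> * t) - Q / 2 * sin (\<omega> * t)))"
    proof (rule oscillator_gauge)
      show "- (\<omega> * \<omega>) = Q^2 / 4 - P" using \<omega>(2) by simp
    qed (auto intro!: derivative_eq_intros)
    \<comment> \<open>After half an oscillation \<open>x\<close> vanishes again and the velocity is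
      reversed, so \<open>b\<close> is an eigenvector of the time-\<open>d\<close> map with a
      negative multiplier.\<close>
    define d where "d = pi / \<omega>"
    have d: "0 < d" "\<omega> * d = pi" using \<omega> by (auto simp: d_def)
    have "exp ((\<sigma> - Q / 2) * d) = exp (\<sigma> * d) * exp (- (Q * d / 2))"
      by (simp add: left_diff_distrib flip: exp_add)
    then have "\<exists>z. reach A b K (\<lambda>_. \<rho>) 0 d (\<omega> *\<^sub>R b) ((- exp ((\<sigma> - Q / 2) * d)) *\<^sub>R \<omega> *\<^sub>R b) z"
      using reach[OF osc, of d] d by (simp add: mult_ac)
    then obtain z where "reach A b K (\<lambda>_. \<rho>) 0 d (\<omega> *\<^sub>R b) ((- exp ((\<sigma> - Q / 2) * d)) *\<^sub>R \<omega> *\<^sub>R b) z" ..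
    then show ?thesis
      by (rule lyap_max_ge)
        (use \<open>Q \<le> 2 * C\<close> d \<omega> b in \<open>auto simp: C_def intro!: mult_right_mono\<close>)
  qed
qed

lemma switched_gain_lyap_max:
  fixes A :: "real^'n^'n"
  assumes Ab: "A *v b = e + \<sigma> *\<^sub>R b" and Ae: "A *v e = \<sigma> *\<^sub>R e + a *\<^sub>R b" and b: "b \<noteq> 0"
    and T: "0 < T" and \<rho>: "\<rho> \<le> 1 / 2000"
    and pos: "0 < K \<bullet> b" "0 < K \<bullet> e"
    and \<kappa>: "\<kappa> = min ((K \<bullet> e) / (K \<bullet> b)) (sqrt (K \<bullet> e))"
    and large: "700 / T \<le> \<kappa>" "\<bar>a\<bar> / \<kappa>^2 * 3000000 * exp 100 \<le> 1"
  shows "\<exists>\<alpha>\<in>PE T (\<rho> * T). ereal \<sigma> \<le> lyap_max A b K \<alpha>"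
proof -
  have \<kappa>0: "0 < \<kappa>" using pos by (simp add: \<kappa>)
  let ?F = "(0 * (K \<bullet> e) - a) / \<kappa>^2" and ?G = "0 * (K \<bullet> b) / \<kappa>"
  let ?P = "(1 * (K \<bullet> e) - a) / \<kappa>^2" and ?Q = "1 * (K \<bullet> b) / \<kappa>"
  have weak: "\<bar>v t - v 0\<bar> \<le> 1 / 100"
    if "oscillator ?F ?G x v" "\<bar>x 0\<bar> \<le> 204" "\<bar>v 0\<bar> \<le> 204" "0 \<le> t" "t \<le> 100" for x v t
    using oscillator_weak_force[of "- a / \<kappa>^2" x v t] that large(2) by (simp add: abs_divide)

  obtain x1 v1 where osc1: "oscillator ?F ?G x1 v1" and ini1: "x1 0 = 0" "v1 0 = 1"
    using oscillator_exists[of ?F ?G 0 1] by blast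
  have v1: "99 / 100 \<le> v1 t \<and> v1 t \<le> 101 / 100" if "0 \<le> t" "t \<le> 100" for t
  proof -
    have "\<bar>v1 t - 1\<bar> \<le> 1 / 100" using weak[OF osc1 _ _ that] ini1 by simp
    then show ?thesis by linarith
  qed
  have x1: "99 \<le> x1 100" "x1 100 \<le> 101"
    using oscillator_displacement[OF osc1, of 100 "99/100" "101/100"] v1 ini1 by auto

  obtain x2 v2 where osc2: "oscillator ?P ?Q x2 v2" and ini2: "x2 0 = x1 100" "v2 0 = v1 100"
    using oscillator_exists[of ?P ?Q "x1 100" "v1 100"] by blast
  define q where "q = a / \<kappa>^2"
  have q: "\<bar>q\<bar> \<le> 1 / 2"
  proof -
    have "\<bar>q\<bar> * 3000000 * 1 \<le> \<bar>q\<bar> * 3000000 * exp 100"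
      by (intro mult_left_mono) auto
    also have "\<dots> \<le> 1" using large(2) by (simp add: q_def abs_divide)
    finally show ?thesis by simp
  qed
  \<comment> \<open>This is what the minimum in \<open>\<kappa>\<close> achieves. If the square root
    is the minimum, then \<open>?P = 1 - q\<close> and \<open>?Q \<le> 1\<close>; otherwise
    \<open>?P = ?Q - q\<close> and \<open>1 \<le> ?Q\<close>. Both regimes meet the hypotheses of
    \<open>oscillator_reversal\<close>.\<close>
  have PQ: "1 / 2 \<le> ?P" "0 \<le> ?Q" "?Q \<le> 2 * ?P" "?P \<le> 2 \<or> ?P \<le> 2 * ?Q"
  proof -
    have q': "- (1 / 2) \<le> q" "q \<le> 1 / 2" using q by linarith+
    have small: "1 / 2 \<le> 1 - q \<and> 0 \<le> y \<and> y \<le> 2 * (1 - q) \<and> (1 - q \<le> 2 \<or> 1 - q \<le> 2 * y)"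
      if "0 \<le> y" "y \<le> 1" for y using that q' by (intro conjI disjI1) simp_all
    have big: "1 / 2 \<le> y - q \<and> 0 \<le> y \<and> y \<le> 2 * (y - q) \<and> (y - q \<le> 2 \<or> y - q \<le> 2 * y)"
      if "1 \<le> y" for y using that q' by (intro conjI disjI2) simp_all
    have "1 / 2 \<le> ?P \<and> 0 \<le> ?Q \<and> ?Q \<le> 2 * ?P \<and> (?P \<le> 2 \<or> ?P \<le> 2 * ?Q)"
    proof (cases "\<kappa> = sqrt (K \<bullet> e)")
      case True
      then have sq: "\<kappa>^2 = K \<bullet> e" using pos by simp
      have P: "?P = 1 - q" using pos by (simp add: q_def sq diff_divide_distrib)
      have "\<kappa> \<le> (K \<bullet> e) / (K \<bullet> b)" by (simp add: \<kappa>)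
      then have "\<kappa> * (K \<bullet> b) \<le> \<kappa> * \<kappa>" using pos sq by (simp add: field_simps power2_eq_square)
      then have "?Q \<le> 1" using \<kappa>0 by simp
      moreover have "0 \<le> ?Q" using pos \<kappa>0 by simp
      ultimately show ?thesis unfolding P by (rule small[rotated])
    next
      case False
      then have k: "\<kappa> = (K \<bullet> e) / (K \<bullet> b)" by (auto simp: \<kappa> min_def split: if_splits)
      have "\<kappa> \<le> sqrt (K \<bullet> e)" by (simp add: \<kappa>)
      then have sq: "\<kappa>^2 \<le> K \<bullet> e" using \<kappa>0 pos
        power_mono[of \<kappa> "sqrt (K \<bullet> e)" 2] by simp
      have Q: "?Q = (K \<bullet> e) / \<kappa>^2" using pos \<kappa>0 by (simp add: k field_simps power2_eq_square)
      have P: "?P = ?Q - q" unfolding Q by (simp add: q_def diff_divide_distrib)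
      have "1 \<le> ?Q" unfolding Q using sq \<kappa>0 by simp
      then show ?thesis unfolding P by (rule big)
    qed
    then show "1 / 2 \<le> ?P" "0 \<le> ?Q" "?Q \<le> 2 * ?P" "?P \<le> 2 \<or> ?P \<le> 2 * ?Q" by blast+
  qed
  note rev = oscillator_reversal[OF osc2 PQ]
  have X: "48 \<le> x2 (1/4)" "x2 (1/4) \<le> 102" and V: "-204 \<le> v2 (1/4)" "v2 (1/4) \<le> -2"
    using rev x1 v1[of 100] by (auto simp: ini2)

  obtain x3 v3 where osc3: "oscillator ?F ?G x3 v3" and ini3: "x3 0 = x2 (1/4)" "v3 0 = v2 (1/4)"
    using oscillator_exists[of ?F ?G "x2 (1/4)" "v2 (1/4)"] by blast
  have v3: "-206 \<le> v3 t \<and> v3 t \<le> - 3 / 2" if "0 \<le> t" "t \<le> 100" for t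
  proof -
    have "\<bar>v3 t - v3 0\<bar> \<le> 1 / 100" using weak[OF osc3 _ _ that] ini3 X V by linarith
    then show ?thesis using ini3(2) V by linarith
  qed
  \<comment> \<open>The return starts at most at 102 with speed at least \<open>3 / 2\<close>, and
    \<open>102 - 70 * (3 / 2)\<close> is negative. The exact return time \<open>D\<close> depends on
    the gain but never exceeds 70.\<close>
  have "x3 70 \<le> 0"
    using oscillator_displacement(2)[OF osc3, of 70 "-206" "- 3 / 2"] v3 ini3 X by auto
  moreover have "continuous_on {0..70} x3"
    using oscillatorD(1)[OF osc3] by (meson DERIV_isCont continuous_at_imp_continuous_on)
  ultimately obtain D where D: "0 \<le> D" "D \<le> 70" "x3 D = 0"
    using IVT2'[of x3 70 0 0] ini3 X by auto
  have v3D: "v3 D \<le> -1" using v3[of D] D by simp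

  define s1 where "s1 = 0 + 100 / \<kappa>"
  define s2 where "s2 = s1 + (1 / 4) / \<kappa>"
  define s3 where "s3 = s2 + D / \<kappa>"
  define \<alpha> where "\<alpha> = pulse s3 s1 s2"
  have s: "0 \<le> s1" "s1 \<le> s2" "s2 \<le> s3" "0 < s3"
  proof -
    have "0 < 100 / \<kappa>" "0 < (1 / 4) / \<kappa>" "0 \<le> D / \<kappa>" using \<kappa>0 D by auto
    then show "0 \<le> s1" "s1 \<le> s2" "s2 \<le> s3" "0 < s3"
      unfolding s3_def s2_def s1_def by linarith+
  qed
  have \<alpha>: "\<alpha> r = indicator {s1..<s2} r" if "0 \<le> r" "r < s3" for r
    using pulse_on_period[of 0 s3 r] that s by (simp add: \<alpha>_def)
  have s3: "s3 = (100 + 1 / 4 + D) / \<kappa>" by (simp add: s1_def s2_def s3_def add_divide_distrib)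
  \<comment> \<open>In rescaled time the cycle lasts at most 170.25. Four cycles therefore last at
    most 681, which the bound \<open>700 / T \<le> \<kappa>\<close> fits into \<open>T\<close>, and
    the burst of length \<open>1 / 4\<close> covers at least 1/681 of a cycle, more than
    \<open>2 * \<rho>\<close>.\<close>
  have "\<alpha> \<in> PE T (\<rho> * T)"
    unfolding \<alpha>_def
  proof (rule pulse_PE)
    have "4 * s3 = (4 * (100 + 1 / 4 + D)) / \<kappa>" by (simp only: s3 times_divide_eq_right)
    also have "\<dots> \<le> 700 / \<kappa>" using D \<kappa>0 by (intro divide_right_mono) auto
    also have "\<dots> \<le> T" using large(1) T \<kappa>0 by (simp add: field_simps)
    finally show "4 * s3 \<le> T" .
    have "(2 * \<rho>) * (100 + 1 / 4 + D) \<le> (2 * (1 / 2000)) * (100 + 1 / 4 + D)"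
      using \<rho> D by (intro mult_right_mono) auto
    also have "\<dots> \<le> 1 / 4" using D by simp
    finally have "(2 * \<rho>) * (100 + 1 / 4 + D) / \<kappa> \<le> (1 / 4) / \<kappa>"
      using \<kappa>0 by (intro divide_right_mono) auto
    then show "2 * \<rho> * s3 \<le> s2 - s1"
      by (simp only: s3 s2_def add_diff_cancel_left' times_divide_eq_right)
  qed (use s in auto)

  let ?E = "\<lambda>d. exp (\<sigma> * d / \<kappa>)"
  obtain z1 where r1: "reach A b K \<alpha> 0 s1 (x1 0 *\<^sub>R e + (\<kappa> * v1 0) *\<^sub>R b)
      (?E 100 *\<^sub>R (x1 100 *\<^sub>R e + (\<kappa> * v1 100) *\<^sub>R b)) z1"
    using oscillator_reach[OF Ab Ae \<kappa>0 osc1, of 0 100 \<alpha>, folded s1_def] \<alpha> s by auto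
  obtain z2 where r2: "reach A b K \<alpha> s1 s2 (x1 100 *\<^sub>R e + (\<kappa> * v1 100) *\<^sub>R b)
      (?E (1/4) *\<^sub>R (x2 (1/4) *\<^sub>R e + (\<kappa> * v2 (1/4)) *\<^sub>R b)) z2"
    using oscillator_reach[OF Ab Ae \<kappa>0 osc2, of s1 "1/4" \<alpha>, folded s2_def] \<alpha> s unfolding ini2 by auto
  obtain z3 where r3: "reach A b K \<alpha> s2 s3 (x2 (1/4) *\<^sub>R e + (\<kappa> * v2 (1/4)) *\<^sub>R b)
      (?E D *\<^sub>R (x3 D *\<^sub>R e + (\<kappa> * v3 D) *\<^sub>R b)) z3"
    using oscillator_reach[OF Ab Ae \<kappa>0 osc3, of s2 D \<alpha>, folded s3_def] \<alpha> s D(1) unfolding ini3 by auto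
  have "\<exists>z. reach A b K \<alpha> 0 s3 (x1 0 *\<^sub>R e + (\<kappa> * v1 0) *\<^sub>R b)
      (?E 100 *\<^sub>R ?E (1/4) *\<^sub>R ?E D *\<^sub>R (x3 D *\<^sub>R e + (\<kappa> * v3 D) *\<^sub>R b)) z"
  proof -
    have "s1 \<le> s2" "0 \<le> s2" using s by auto
    note r12 = reach_trans[OF r1 reach_scaleR[OF r2] s(1) \<open>s1 \<le> s2\<close>]
    show ?thesis
      by (rule exI, rule reach_trans[OF r12 reach_scaleR[OF reach_scaleR[OF r3]] \<open>0 \<le> s2\<close> s(3)])
  qed
  moreover have "exp (\<sigma> * s3) = ?E 100 * ?E (1/4) * ?E D"
    by (simp only: s3 add_divide_distrib distrib_left times_divide_eq_right exp_add)
  \<comment> \<open>Both end states have zero \<open>e\<close>-component, so the cycle maps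
    \<open>b\<close> to a multiple of itself. As \<open>v3 D \<le> -1\<close>, the modulus of the
    multiplier is at least \<open>exp (\<sigma> * s3)\<close>.\<close>
  ultimately have "\<exists>z. reach A b K \<alpha> 0 s3 (\<kappa> *\<^sub>R b) ((exp (\<sigma> * s3) * v3 D) *\<^sub>R \<kappa> *\<^sub>R b) z"
    by (simp add: ini1 D(3) mult_ac)
  then obtain z where "reach A b K \<alpha> 0 s3 (\<kappa> *\<^sub>R b) ((exp (\<sigma> * s3) * v3 D) *\<^sub>R \<kappa> *\<^sub>R b) z" ..
  then have "ereal \<sigma> \<le> lyap_max A b K \<alpha>"
    by (rule lyap_max_ge)
      (use s \<kappa>0 b v3D mult_left_mono[of 1 "- v3 D" "exp (\<sigma> * s3)"] in \<open>auto simp: \<alpha>_def pulse_periodic abs_mult\<close>)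
  with \<open>\<alpha> \<in> PE T (\<rho> * T)\<close> show ?thesis by blast
qed

section \<open>Companion form of a planar controllable pair and the distinction on the gain\<close>

lemma controllable_imp_not_eigenvector:
  fixes A :: "real^'n^'n"
  assumes "controllable A b" "1 < CARD('n)"
  shows "A *v b \<noteq> c *\<^sub>R b"
proof
  assume eq: "A *v b = c *\<^sub>R b"
  have "(((*v) A) ^^ i) b \<in> span {b}" for i
  proof (induction i)
    case (Suc i)
    then obtain k where "(((*v) A) ^^ i) b = k *\<^sub>R b" by (auto simp: span_singleton)
    then show ?case by (simp add: matrix_vector_mult_scaleR eq span_mul span_base)
  qed (simp add: span_base)
  then have "dim {(((*v) A) ^^ i) b | i. i < CARD('n)} \<le> card {b}"
    by (intro dim_le_card) auto
  with assms show False by (simp add: controllable_def)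
qed

text \<open>Cayley-Hamilton: since \<open>\<sigma>\<close> is half the trace, the square of
  \<open>A\<close> minus \<open>\<sigma>\<close> times the identity is the scalar
  \<open>\<sigma>^2\<close> minus the determinant.\<close>

lemma two_by_two_companion:
  fixes A :: "real^2^2" and b :: "real^2"
  defines "\<sigma> \<equiv> (A$1$1 + A$2$2) / 2"
  defines "e \<equiv> A *v b - \<sigma> *\<^sub>R b"
  shows "A *v b = e + \<sigma> *\<^sub>R b"
    and "A *v e = \<sigma> *\<^sub>R e + (\<sigma>^2 - (A$1$1 * A$2$2 - A$1$2 * A$2$1)) *\<^sub>R b"
proof -
  show "A *v b = e + \<sigma> *\<^sub>R b" by (simp add: e_def)
  have trace: "A$1$1 = 2 * \<sigma> - A$2$2" by (simp add: \<sigma>_def field_simps)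
  show "A *v e = \<sigma> *\<^sub>R e + (\<sigma>^2 - (A$1$1 * A$2$2 - A$1$2 * A$2$1)) *\<^sub>R b"
    by (simp add: e_def vec_eq_iff forall_2 matrix_vector_mult_def sum_2 power2_eq_square algebra_simps trace)
qed

theorem proposition4p5:
  shows "\<exists>\<rho>s::real. 0 < \<rho>s \<and> \<rho>s < 1 \<and>
    (\<forall>(A::real^2^2) (b::real^2) (T::real) (\<rho>::real).
       controllable A b \<longrightarrow> 0 < T \<longrightarrow> 0 < \<rho> \<longrightarrow> \<rho> < \<rho>s \<longrightarrow> RC A b T (\<rho> * T) < \<infinity>)"
proof (rule exI[of _ "1 / 2000"], intro conjI allI impI)
  fix A :: "real^2^2" and b :: "real^2" and T \<rho> :: real
  assume ctr: "controllable A b" and T: "0 < T" and \<rho>: "0 < \<rho>" "\<rho> < 1 / 2000"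
  define \<sigma> where "\<sigma> = (A$1$1 + A$2$2) / 2"
  define e where "e = A *v b - \<sigma> *\<^sub>R b"
  define a where "a = \<sigma>^2 - (A$1$1 * A$2$2 - A$1$2 * A$2$1)"
  have Ab: "A *v b = e + \<sigma> *\<^sub>R b" and Ae: "A *v e = \<sigma> *\<^sub>R e + a *\<^sub>R b"
    using two_by_two_companion[of A b] by (simp_all only: \<sigma>_def e_def a_def)
  have not_eig: "A *v b \<noteq> c *\<^sub>R b" for c
    by (rule controllable_imp_not_eigenvector[OF ctr]) simp
  have b: "b \<noteq> 0" using not_eig[of 0] by auto
  have ind: "e + r *\<^sub>R b \<noteq> 0" for r
    using not_eig[of "\<sigma> - r"] by (auto simp: e_def algebra_simps)
  \<comment> \<open>The summands make \<open>\<kappa>\<close> at least 1, the cycle short compared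
    with \<open>T\<close>, and the force \<open>a\<close> negligible after rescaling,
    respectively.\<close>
  define N where "N = 1 + 700 / T + \<bar>a\<bar> * 3000000 * exp 100"
  have N: "1 \<le> N" "700 / T \<le> N" "\<bar>a\<bar> * 3000000 * exp 100 \<le> N"
    using T by (auto simp: N_def)
  define C where "C = 4 * N + 2 * \<bar>a\<bar> + 2"
  \<comment> \<open>The constant \<open>C\<close> involves only \<open>a\<close> and
    \<open>T\<close>, so the bound is uniform in the gain.\<close>
  have "rc A b T (\<rho> * T) K \<le> ereal (C - \<sigma>)" for K
  proof -
    have "\<exists>\<alpha>\<in>PE T (\<rho> * T). ereal (\<sigma> - C) \<le> lyap_max A b K \<alpha>"
    proof (cases "K \<bullet> b \<le> N \<or> K \<bullet> e \<le> N * (K \<bullet> b)")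
      case True
      show ?thesis
        by (rule bexI[OF _ const_PE], unfold C_def, rule constant_gain_lyap_max[OF Ab Ae ind b])
           (use True N T \<rho> in auto)
    next
      case False
      define \<kappa> where "\<kappa> = min ((K \<bullet> e) / (K \<bullet> b)) (sqrt (K \<bullet> e))"
      \<comment> \<open>The failure of both alternatives makes both candidates for
        \<open>\<kappa>\<close> at least \<open>N\<close>: the ratio directly, and the square root
        because \<open>K \<bullet> e\<close> exceeds \<open>N * N\<close>.\<close>
      have k: "N < K \<bullet> b" "N * (K \<bullet> b) < K \<bullet> e" using False by auto
      then have pos: "0 < K \<bullet> b" using N(1) by linarith
      have "N * N \<le> N * (K \<bullet> b)" using k N(1) by (intro mult_left_mono) auto
      with k have "N * N \<le> K \<bullet> e" by linarith
      then have "sqrt (N * N) \<le> sqrt (K \<bullet> e)" by (rule real_sqrt_le_mono)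
      then have "N \<le> \<kappa>" using k pos N(1) by (simp add: \<kappa>_def field_simps)
      moreover have "0 < K \<bullet> e" using \<open>N * N \<le> K \<bullet> e\<close> N(1) mult_mono[of 1 N 1 N] by linarith
      moreover have "\<bar>a\<bar> / \<kappa>^2 * 3000000 * exp 100 \<le> 1"
      proof -
        have "\<bar>a\<bar> * 3000000 * exp 100 \<le> \<kappa>" using N \<open>N \<le> \<kappa>\<close> by linarith
        also have "\<dots> \<le> \<kappa>^2" using N \<open>N \<le> \<kappa>\<close> by (simp add: power2_eq_square)
        finally show ?thesis using N \<open>N \<le> \<kappa>\<close> by (simp add: divide_simps)
      qed
      ultimately obtain \<alpha> where "\<alpha> \<in> PE T (\<rho> * T)" "ereal \<sigma> \<le> lyap_max A b K \<alpha>"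
        using switched_gain_lyap_max[OF Ab Ae b T _ pos _ \<kappa>_def, of \<rho>] N \<rho> by force
      moreover have "ereal (\<sigma> - C) \<le> ereal \<sigma>" using N by (simp add: C_def)
      ultimately show ?thesis by (meson order_trans)
    qed
    then have "ereal (\<sigma> - C) \<le> (SUP \<alpha>\<in>PE T (\<rho> * T). lyap_max A b K \<alpha>)"
      by (meson SUP_upper2)
    then have "rc A b T (\<rho> * T) K \<le> - ereal (\<sigma> - C)"
      unfolding rc_def by (simp only: ereal_minus_le_minus)
    then show ?thesis by simp
  qed
  then have "RC A b T (\<rho> * T) \<le> ereal (C - \<sigma>)"
    unfolding RC_def by (intro SUP_least)
  then show "RC A b T (\<rho> * T) < \<infinity>" by (rule order_le_less_trans) simp
qed auto

end
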